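(* There exist absolute constants $K_1, K_2, K_3 > 0$ such that the following holds. Let $A \subset \mathbb{C}$ be a set of $N$ complex numbers and let $C$ be a real number with $C \geq K_1$ and $\sqrt{N} \geq K_2 C$, where $K_1, K_2$ are sufficiently large (in particular $K_1, K_2 > 1$). Define $$T_C = \left\{ t \in \mathbb{C} \,:\, |A + tA| \leq \frac{N^{1.5}}{C \sqrt{\log N}} \right\}.$$ Then $$|T_C| \leq K_3 \cdot \frac{N}{C^2}.$$
   Context: For $A \subset \mathbb{C}$ and $t \in \mathbb{C}$, $A + tA = \{a + t a' : a, a' \in A\}$. *)

theory Defs
  imports Complex_Main
begin

definition sum_of_dilate :: "complex set \<Rightarrow> complex \<Rightarrow> complex set" where
  "sum_of_dilate A t = {a + t * a' | a a'. a \<in> A \<and> a' \<in> A}"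

text \<open>The set \<open>T\<^sub>C\<close>, with \<open>N = card A\<close> and the natural logarithm. It is meant for finite
  \<open>A\<close> with at least two elements, so that the denominator is nonzero.\<close>

definition T_set :: "complex set \<Rightarrow> real \<Rightarrow> complex set" where
  "T_set A C = {t. real (card (sum_of_dilate A t))
                     \<le> real (card A) powr 1.5 / (C * sqrt (ln (real (card A))))}"

end

theory Submission
  imports Defs
begin

text \<open>
  This is the disc argument of Solymosi and Tardos for rich lines of a Cartesian product.
  A pair \<open>(t, s)\<close> is a complex line, the graph of \<open>\<phi> z = s - t z\<close>; let \<open>S = {a \<in> A. \<phi> a \<in> A}\<close>
  and let \<open>n a\<close> be a nearest neighbour of \<open>a\<close> in \<open>S\<close>. The discs around \<open>a \<in> S\<close> through
  \<open>n a\<close> cover no point more than 9 times, and since \<open>\<phi>\<close> is a similarity the same holds for their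
  images. Hence for at least a third of the \<open>a \<in> S\<close> both the disc and its image contain only
  \<open>O(N / card S)\<close> points of \<open>A\<close>. There are only \<open>O(N\<^sup>2 (N / k)\<^sup>2)\<close> quadruples
  \<open>((a, a'), (b, b'))\<close> in which \<open>a'\<close> is among the \<open>O(N / k)\<close> points nearest to \<open>a\<close> and likewise
  \<open>b'\<close> for \<open>b\<close>, and each of them determines the line.

  If \<open>A + t A\<close> has at most \<open>M\<close> elements, the lines with parameter \<open>t\<close> that are at least
  \<open>k = N\<^sup>2 / (2 M)\<close>-rich carry at least half of the \<open>N\<^sup>2\<close> points of \<open>A \<times> A\<close>. Counting quadruples over
  all such \<open>t\<close> bounds their number by \<open>O(M\<^sup>2 / N\<^sup>2)\<close>, even without the logarithmic factor.
\<close>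

section \<open>Bounded overlap of nearest-neighbour discs\<close>

definition octant :: "complex \<Rightarrow> bool \<times> bool \<times> bool" where
  "octant z = (Re z \<ge> 0, Im z \<ge> 0, \<bar>Im z\<bar> \<le> \<bar>Re z\<bar>)"

text \<open>If \<open>x < u\<close>, then \<open>x * x + y * y\<close> is at most
  \<open>2 * x * x < 2 * x * u\<close>; ties in the first coordinate are broken by the
  second.\<close>

lemma octant_inner_aux:
  fixes x y u v :: real
  assumes "0 \<le> y" "y \<le> x" "0 \<le> v" "v \<le> u" "0 < x" "0 < u"
  shows "x\<^sup>2 + y\<^sup>2 < 2 * (x * u + y * v) \<or> u\<^sup>2 + v\<^sup>2 < 2 * (x * u + y * v)"
proof -
  have *: "x\<^sup>2 + y\<^sup>2 < 2 * (x * u + y * v)"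
    if "0 \<le> y" "y \<le> x" "0 \<le> v" "v \<le> u" "0 < x" "x < u \<or> x = u \<and> y \<le> v" for x y u v :: real
    using that(6)
  proof
    assume "x < u"
    then have "x * x < x * u" using that by simp
    moreover have "y * y \<le> x * x" using that by (intro mult_mono) auto
    moreover have "0 \<le> y * v" using that by simp
    ultimately show ?thesis by (simp add: power2_eq_square)
  next
    assume "x = u \<and> y \<le> v"
    moreover from this have "y * y \<le> y * v" using that by (intro mult_left_mono) auto
    moreover have "0 < x * x" "0 \<le> y * v" using that by auto
    ultimately have "x * x + y * y < 2 * (x * u + y * v)" by (auto simp: algebra_simps)
    then show ?thesis by (simp add: power2_eq_square)
  qed
  consider "x < u \<or> x = u \<and> y \<le> v" | "u < x \<or> u = x \<and> v \<le> y" by linarith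
  then show ?thesis
  proof cases
    case 1 then show ?thesis using *[of y x v u] assms by blast
  next
    case 2 then show ?thesis using *[of v u y x] assms by (auto simp: mult.commute)
  qed
qed

text \<open>Nonzero numbers in one octant form an angle of at most 45 degrees. This is below 60
  degrees, so in the triangle \<open>0\<close>, \<open>z\<close>, \<open>w\<close> the opposite side
  is not a longest one.\<close>

lemma same_octant_norm_diff_less:
  assumes "octant z = octant w" "z \<noteq> 0" "w \<noteq> 0"
  shows "norm (z - w) < max (norm z) (norm w)"
proof -
  define i where "i = \<bar>Re z\<bar> * \<bar>Re w\<bar> + \<bar>Im z\<bar> * \<bar>Im w\<bar>"
  \<comment> \<open>Equal octants mean matching signs, so neither product is negative.\<close>
  have i: "Re z * Re w + Im z * Im w = i"
    using assms(1) unfolding i_def octant_def by (auto simp: abs_if)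
  have "(norm z)\<^sup>2 < 2 * i \<or> (norm w)\<^sup>2 < 2 * i"
  proof (cases "\<bar>Im z\<bar> \<le> \<bar>Re z\<bar>")
    case True
    then have "\<bar>Im w\<bar> \<le> \<bar>Re w\<bar>" using assms(1) by (simp add: octant_def)
    moreover have "0 < \<bar>Re z\<bar>" "0 < \<bar>Re w\<bar>"
      using True calculation assms(2,3) by (auto simp: complex_eq_iff)
    ultimately show ?thesis
      using octant_inner_aux[of "\<bar>Im z\<bar>" "\<bar>Re z\<bar>" "\<bar>Im w\<bar>" "\<bar>Re w\<bar>"] True
      by (simp add: cmod_power2 i_def)
  next
    case False
    then have "\<bar>Re z\<bar> \<le> \<bar>Im z\<bar>" "\<bar>Re w\<bar> \<le> \<bar>Im w\<bar>" using assms(1) by (auto simp: octant_def)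
    moreover have "0 < \<bar>Im z\<bar>" "0 < \<bar>Im w\<bar>"
      using calculation assms(2,3) by (auto simp: complex_eq_iff)
    ultimately show ?thesis
      using octant_inner_aux[of "\<bar>Re z\<bar>" "\<bar>Im z\<bar>" "\<bar>Re w\<bar>" "\<bar>Im w\<bar>"]
      by (simp add: cmod_power2 i_def add.commute)
  qed
  moreover have "(norm (z - w))\<^sup>2 = (norm z)\<^sup>2 + (norm w)\<^sup>2 - 2 * i"
    unfolding i[symmetric] cmod_power2 by (simp add: power2_eq_square algebra_simps)
  ultimately have "(norm (z - w))\<^sup>2 < (norm z)\<^sup>2 \<or> (norm (z - w))\<^sup>2 < (norm w)\<^sup>2"
    by linarith
  then have "norm (z - w) < norm z \<or> norm (z - w) < norm w"
    using power2_less_imp_less[of "norm (z - w)"] by auto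
  then show ?thesis by auto
qed

text \<open>Two centres that \<open>p\<close> sees in the same octant would be closer to each other
  than one of them is to \<open>p\<close>, hence closer than its radius, against
  \<open>near\<close>. So each of the 8 octants holds at most one centre, and \<open>p\<close>
  itself may be a ninth.\<close>

lemma nearest_discs_overlap:
  fixes S :: "complex set" and n :: "complex \<Rightarrow> complex"
  assumes "finite S"
    and near: "\<And>a b. a \<in> S \<Longrightarrow> b \<in> S \<Longrightarrow> b \<noteq> a \<Longrightarrow> dist a (n a) \<le> dist a b"
  shows "card {a \<in> S. dist a p \<le> dist a (n a)} \<le> 9"
proof -
  define D where "D = {a \<in> S. dist a p \<le> dist a (n a)}"
  have "finite D" using assms(1) by (simp add: D_def)
  have "inj_on (\<lambda>a. octant (a - p)) (D - {p})"
  proof (rule inj_onI, rule ccontr)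
    fix a b assume ab: "a \<in> D - {p}" "b \<in> D - {p}" "octant (a - p) = octant (b - p)" "a \<noteq> b"
    then have "norm ((a - p) - (b - p)) < max (norm (a - p)) (norm (b - p))"
      by (intro same_octant_norm_diff_less) auto
    then have "dist a b < max (dist a p) (dist b p)" by (simp add: dist_norm)
    moreover have "dist a p \<le> dist a b" "dist b p \<le> dist a b"
      using ab near[of a b] near[of b a] by (auto simp: D_def dist_commute)
    ultimately show False by simp
  qed
  then have "card (D - {p}) \<le> card (UNIV :: (bool \<times> bool \<times> bool) set)"
    by (intro card_inj_on_le) auto
  also have "\<dots> = 8" by (simp add: UNIV_Times_UNIV[symmetric] card_cartesian_product del: UNIV_Times_UNIV)
  finally have "card (D - {p}) \<le> 8" .
  moreover have "card D - card {p} \<le> card (D - {p})" by (intro diff_card_le_card_Diff) simp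
  ultimately show ?thesis unfolding D_def by simp
qed

text \<open>Markov's inequality: by bounded overlap the disc counts sum to at most
  \<open>9 * card B\<close>. Keeping \<open>B\<close> independent of \<open>S\<close> allows one use
  for the discs and one for their images.\<close>

lemma few_rich_nearest_discs:
  fixes S B :: "complex set" and n :: "complex \<Rightarrow> complex" and m :: real
  assumes "finite S" "finite B"
    and near: "\<And>a b. a \<in> S \<Longrightarrow> b \<in> S \<Longrightarrow> b \<noteq> a \<Longrightarrow> dist a (n a) \<le> dist a b"
  shows "real (card {a \<in> S. m < real (card {p \<in> B. dist a p \<le> dist a (n a)})}) * m \<le> 9 * card B"
proof -
  let ?c = "\<lambda>a. card {p \<in> B. dist a p \<le> dist a (n a)}"
  let ?R = "{a \<in> S. m < real (?c a)}"
  have "real (card ?R) * m \<le> (\<Sum>a\<in>?R. real (?c a))"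
    using sum_mono[of ?R "\<lambda>_. m" "\<lambda>a. real (?c a)"] by simp
  also have "\<dots> \<le> (\<Sum>a\<in>S. real (?c a))" using assms(1) by (intro sum_mono2) auto
  also have "\<dots> = real (\<Sum>a\<in>S. ?c a)" by simp
  also have "(\<Sum>a\<in>S. ?c a) = (\<Sum>p\<in>B. card {a \<in> S. dist a p \<le> dist a (n a)})"
    using assms by (intro sum_multicount_gen) auto
  also have "\<dots> \<le> card B * 9"
    using sum_mono[of B "\<lambda>p. card {a \<in> S. dist a p \<le> dist a (n a)}" "\<lambda>_. 9"]
      nearest_discs_overlap[OF assms(1) near] by simp
  finally show ?thesis by simp
qed

lemma nearest_point_exists:
  fixes S :: "'a :: metric_space set"
  assumes "finite S" "2 \<le> card S"
  obtains n where "\<And>a. a \<in> S \<Longrightarrow> n a \<in> S" "\<And>a. a \<in> S \<Longrightarrow> n a \<noteq> a"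
    "\<And>a b. a \<in> S \<Longrightarrow> b \<in> S \<Longrightarrow> b \<noteq> a \<Longrightarrow> dist a (n a) \<le> dist a b"
proof -
  have "\<exists>b. b \<in> S - {a} \<and> (\<forall>c \<in> S - {a}. dist a b \<le> dist a c)" if "a \<in> S" for a
  proof -
    have "card (S - {a}) \<noteq> 0" using assms that by simp
    then have ne: "finite (S - {a})" "S - {a} \<noteq> {}" using assms(1) by auto
    show ?thesis
      using arg_min_if_finite(1)[OF ne, of "dist a"] arg_min_least[OF ne, of _ "dist a"] by blast
  qed
  then obtain n where "\<And>a. a \<in> S \<Longrightarrow> n a \<in> S - {a} \<and> (\<forall>c \<in> S - {a}. dist a (n a) \<le> dist a c)"
    by metis
  then show ?thesis by (intro that[of n]) auto
qed

section \<open>Close pairs and the quadruples they form on a line\<close>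

definition near_pairs :: "complex set \<Rightarrow> real \<Rightarrow> (complex \<times> complex) set" where
  "near_pairs A m =
    {(a, a'). a \<in> A \<and> a' \<in> A \<and> a \<noteq> a' \<and> real (card {p \<in> A. dist a p \<le> dist a a'}) \<le> m}"

lemma near_pairs_subset: "near_pairs A m \<subseteq> A \<times> A"
  by (auto simp: near_pairs_def)

lemma finite_near_pairs: "finite A \<Longrightarrow> finite (near_pairs A m)"
  using near_pairs_subset by (rule finite_subset) simp

text \<open>All partners of \<open>a\<close> lie in the disc around \<open>a\<close> through the
  farthest partner, and that disc holds at most \<open>m\<close> points of \<open>A\<close>.\<close>

lemma card_near_pairs_le:
  fixes A :: "complex set" and m :: real
  assumes "finite A" "0 \<le> m"
  shows "real (card (near_pairs A m)) \<le> card A * m"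
proof -
  let ?C = "\<lambda>a. {a' \<in> A. a \<noteq> a' \<and> real (card {p \<in> A. dist a p \<le> dist a a'}) \<le> m}"
  have le: "real (card (?C a)) \<le> m" for a
  proof (cases "?C a = {}")
    case True
    then show ?thesis using assms(2) by (simp only: card.empty)
  next
    case False
    have fin: "finite (?C a)" using assms(1) by simp
    have "Max (dist a ` ?C a) \<in> dist a ` ?C a" using fin False by (intro Max_in) auto
    then obtain b where b: "b \<in> ?C a" "Max (dist a ` ?C a) = dist a b" by auto
    have "dist a c \<le> dist a b" if "c \<in> ?C a" for c
      unfolding b(2)[symmetric] using fin that by (intro Max_ge) auto
    then have "?C a \<subseteq> {p \<in> A. dist a p \<le> dist a b}" by blast
    then have "card (?C a) \<le> card {p \<in> A. dist a p \<le> dist a b}"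
      using assms(1) by (intro card_mono) auto
    moreover have "real (card {p \<in> A. dist a p \<le> dist a b}) \<le> m" using b by simp
    ultimately show ?thesis by linarith
  qed
  have "near_pairs A m = Sigma A ?C" by (auto simp: near_pairs_def)
  then have "real (card (near_pairs A m)) = (\<Sum>a\<in>A. real (card (?C a)))"
    using assms(1) by (simp add: card_SigmaI)
  also have "\<dots> \<le> card A * m" using sum_bounded_above[of A "\<lambda>a. real (card (?C a))" m] le by simp
  finally show ?thesis .
qed

text \<open>The points on the line are \<open>(a, b)\<close> and \<open>(a', b')\<close>. Grouping
  by coordinate instead places the quadruples in the square of
  \<open>near_pairs A m\<close>.\<close>

definition line_quads :: "complex set \<Rightarrow> real \<Rightarrow> complex \<Rightarrow> complex \<Rightarrow>
    ((complex \<times> complex) \<times> (complex \<times> complex)) set" where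
  "line_quads A m t s = {((a, a'), (b, b')). (a, a') \<in> near_pairs A m \<and> (b, b') \<in> near_pairs A m
     \<and> b = s - t * a \<and> b' = s - t * a'}"

lemma line_quads_subset: "line_quads A m t s \<subseteq> near_pairs A m \<times> near_pairs A m"
  by (auto simp: line_quads_def)

text \<open>A quadruple gives the values of \<open>z \<mapsto> s - t * z\<close> at two distinct
  points, which determine \<open>t\<close> and \<open>s\<close>.\<close>

lemma line_quads_disjoint:
  assumes "(t, s) \<noteq> (t', s')"
  shows "line_quads A m t s \<inter> line_quads A m t' s' = {}"
proof (rule ccontr)
  assume "line_quads A m t s \<inter> line_quads A m t' s' \<noteq> {}"
  then obtain a a' where *: "a \<noteq> a'" "s - t * a = s' - t' * a" "s - t * a' = s' - t' * a'"
    by (auto simp: line_quads_def near_pairs_def)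
  then have "(t - t') * a = s - s'" "(t - t') * a' = s - s'" by (simp_all add: algebra_simps)
  then have "(t - t') * (a - a') = 0" by (simp add: right_diff_distrib)
  with * assms show False by auto
qed

section \<open>Rich lines contain many quadruples\<close>

lemma dist_affine: "dist (s - t * a) (s - t * b) = norm t * dist a (b :: complex)"
proof -
  have "(s - t * a) - (s - t * b) = - (t * (a - b))" by (simp add: algebra_simps)
  then show ?thesis by (simp add: dist_norm norm_mult)
qed

lemma rich_line_many_quads:
  fixes A :: "complex set" and t s :: complex and k :: real
  assumes "finite A" "t \<noteq> 0" "2 \<le> k"
  defines "S \<equiv> {a \<in> A. s - t * a \<in> A}"
  assumes rich: "k \<le> card S"
  shows "real (card S) / 3 \<le> card (line_quads A (27 * card A / k) t s)"
proof -
  \<comment> \<open>The 27 makes \<open>9 * card A / m\<close> equal to \<open>k / 3\<close>, at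
    most a third of \<open>card S\<close>.\<close>
  define m where "m = 27 * card A / k"
  define \<phi> where "\<phi> = (\<lambda>z. s - t * z)"
  \<comment> \<open>Points of \<open>A\<close> in an image disc correspond under
    \<open>\<phi>\<close> to points of \<open>B\<close> in the original disc, so the image discs
    need no overlap bound of their own.\<close>
  define B where "B = \<phi> -` A"
  have inj: "inj \<phi>" using assms(2) by (auto simp: inj_def \<phi>_def)
  have surj: "surj \<phi>"
    unfolding surj_def \<phi>_def using assms(2) by (auto intro!: exI[of _ "(s - _) / t"])
  have finB: "finite B" unfolding B_def using assms(1) inj by (intro finite_vimageI)
  have cardB: "card B = card A"
    unfolding B_def using inj surj by (intro card_vimage_inj) auto
  have finS: "finite S" using assms(1) by (simp add: S_def)
  have "2 \<le> card S" using rich assms(3) by linarith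
  then obtain n where n: "\<And>a. a \<in> S \<Longrightarrow> n a \<in> S" "\<And>a. a \<in> S \<Longrightarrow> n a \<noteq> a"
    "\<And>a b. a \<in> S \<Longrightarrow> b \<in> S \<Longrightarrow> b \<noteq> a \<Longrightarrow> dist a (n a) \<le> dist a b"
    using nearest_point_exists[OF finS] by metis
  define c where "c = (\<lambda>X a. real (card {p \<in> X. dist a p \<le> dist a (n a)}))"
  have "card A > 0" using \<open>2 \<le> card S\<close> card_mono[OF assms(1), of S] by (auto simp: S_def)
  have few: "real (card {a \<in> S. m < c X a}) \<le> card S / 3"
    if "finite X" "card X = card A" for X
  proof -
    have "real (card {a \<in> S. m < c X a}) * m \<le> 9 * card A"
      using few_rich_nearest_discs[OF finS that(1) n(3), of m] that(2) by (simp add: c_def)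
    then have "real (card {a \<in> S. m < c X a}) * 27 \<le> 9 * k"
      using \<open>card A > 0\<close> assms(3) by (simp add: m_def field_simps)
    then show ?thesis using rich by simp
  qed
  have image: "card {p \<in> A. dist (\<phi> a) p \<le> dist (\<phi> a) (\<phi> b)} = card {p \<in> B. dist a p \<le> dist a b}"
    for a b
  proof -
    let ?D = "{p \<in> A. dist (\<phi> a) p \<le> dist (\<phi> a) (\<phi> b)}"
    have "\<phi> -` ?D = {p \<in> B. dist a p \<le> dist a b}"
      using assms(2) by (auto simp: B_def \<phi>_def dist_affine)
    moreover have "card (\<phi> -` ?D) = card ?D" using inj surj by (intro card_vimage_inj) auto
    ultimately show ?thesis by (simp only:)
  qed
  define G where "G = {a \<in> S. c A a \<le> m \<and> c B a \<le> m}"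
  \<comment> \<open>Each of the two exceptional sets takes away at most a third of
    \<open>S\<close>.\<close>
  have "card S \<le> card (G \<union> ({a \<in> S. m < c A a} \<union> {a \<in> S. m < c B a}))"
    using finS by (intro card_mono) (auto simp: G_def)
  also have "\<dots> \<le> card G + (card {a \<in> S. m < c A a} + card {a \<in> S. m < c B a})"
    by (intro card_Un_le[THEN order_trans] add_mono order_refl card_Un_le)
  finally have "real (card S) / 3 \<le> card G"
    using few[OF assms(1) refl] few[OF finB cardB] by linarith
  also have "card G \<le> card (line_quads A m t s)"
  proof (rule card_inj_on_le)
    show "inj_on (\<lambda>a. ((a, n a), (\<phi> a, \<phi> (n a)))) G" by (auto simp: inj_on_def)
    show "finite (line_quads A m t s)"
      using finite_subset[OF line_quads_subset] finite_near_pairs[OF assms(1)] by blast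
    show "(\<lambda>a. ((a, n a), (\<phi> a, \<phi> (n a)))) ` G \<subseteq> line_quads A m t s"
    proof clarify
      fix a assume "a \<in> G"
      then have a: "a \<in> S" "c A a \<le> m" "c B a \<le> m" by (auto simp: G_def)
      have S: "x \<in> A" "\<phi> x \<in> A" if "x \<in> S" for x using that by (auto simp: S_def \<phi>_def)
      have "(a, n a) \<in> near_pairs A m"
        using a S n(1,2)[OF a(1)] by (auto simp: near_pairs_def c_def)
      moreover have "(\<phi> a, \<phi> (n a)) \<in> near_pairs A m"
        using a S n(1,2)[OF a(1)] injD[OF inj, of a "n a"]
        by (auto simp: near_pairs_def c_def image)
      ultimately show "((a, n a), (\<phi> a, \<phi> (n a))) \<in> line_quads A m t s"
        by (auto simp: line_quads_def \<phi>_def)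
    qed
  qed
  finally show ?thesis by (simp add: m_def)
qed

section \<open>Double counting over dilates with few sums\<close>

lemma finite_sum_of_dilate: "finite A \<Longrightarrow> finite (sum_of_dilate A t)"
  unfolding sum_of_dilate_def by (rule finite_image_set2) auto

text \<open>The lines with parameter \<open>t\<close> partition \<open>A \<times> A\<close>. Those
  with fewer than \<open>k\<close> points number at most \<open>card (sum_of_dilate A t)\<close>, so
  together they cover at most half of it.\<close>

lemma rich_lines_carry_half:
  fixes A :: "complex set" and t :: complex and k :: real
  assumes "finite A" "card (sum_of_dilate A t) * k \<le> (card A)\<^sup>2 / 2"
  defines "r \<equiv> \<lambda>s. real (card {a \<in> A. s - t * a \<in> A})"
  shows "(card A)\<^sup>2 / 2 \<le> (\<Sum>s | s \<in> sum_of_dilate A t \<and> k \<le> r s. r s)"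
proof -
  let ?D = "sum_of_dilate A t"
  have fin: "finite ?D" using assms(1) by (rule finite_sum_of_dilate)
  have one: "card {s \<in> ?D. s - t * a \<in> A} = card A" if "a \<in> A" for a
  proof -
    have "{s \<in> ?D. s - t * a \<in> A} = (\<lambda>b. b + t * a) ` A"
    proof (intro equalityI subsetI)
      fix s assume "s \<in> {s \<in> ?D. s - t * a \<in> A}"
      then show "s \<in> (\<lambda>b. b + t * a) ` A" by (intro image_eqI[of _ _ "s - t * a"]) auto
    qed (use that in \<open>auto simp: sum_of_dilate_def\<close>)
    then show ?thesis by (simp add: card_image inj_on_def)
  qed
  have "(\<Sum>s\<in>?D. card {a \<in> A. s - t * a \<in> A}) = (\<Sum>a\<in>A. card A)"
    using fin assms(1) one by (intro sum_multicount_gen) auto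
  then have "real (\<Sum>s\<in>?D. card {a \<in> A. s - t * a \<in> A}) = real (card A * card A)" by simp
  then have "(card A)\<^sup>2 = (\<Sum>s\<in>?D. r s)" by (simp add: r_def power2_eq_square)
  also have "\<dots> = (\<Sum>s | s \<in> ?D \<and> k \<le> r s. r s) + (\<Sum>s | s \<in> ?D \<and> \<not> k \<le> r s. r s)"
    using fin by (subst sum.union_disjoint[symmetric]) (auto intro!: sum.cong)
  also have "(\<Sum>s | s \<in> ?D \<and> \<not> k \<le> r s. r s) \<le> card {s \<in> ?D. \<not> k \<le> r s} * k"
    using sum_mono[of "{s \<in> ?D. \<not> k \<le> r s}" r "\<lambda>_. k"] by simp
  also have "\<dots> \<le> (card A)\<^sup>2 / 2"
  proof (cases "0 \<le> k")
    case True
    then have "card {s \<in> ?D. \<not> k \<le> r s} * k \<le> card ?D * k"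
      using fin by (intro mult_right_mono) (auto intro: card_mono)
    then show ?thesis using assms(2) by linarith
  next
    case False
    then have "card {s \<in> ?D. \<not> k \<le> r s} * k \<le> 0" by (simp add: mult_nonneg_nonpos)
    then show ?thesis by (rule order_trans) simp
  qed
  finally show ?thesis by linarith
qed

text \<open>The factor 6 combines the 3 lost on each rich line with the 2 lost by keeping only rich
  lines. \<open>T\<close> is taken finite because finiteness of the full parameter set is later
  deduced from this bound.\<close>

lemma card_dilates_le:
  fixes A T :: "complex set" and k :: real
  assumes "finite A" "A \<noteq> {}" "2 \<le> k" "finite T" "0 \<notin> T"
    and small: "\<And>t. t \<in> T \<Longrightarrow> card (sum_of_dilate A t) * k \<le> (card A)\<^sup>2 / 2"
  shows "real (card T) \<le> 6 * (27 * card A / k)\<^sup>2"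
proof -
  define m where "m = 27 * card A / k"
  define r where "r = (\<lambda>t s. real (card {a \<in> A. s - t * a \<in> A}))"
  define I where "I = Sigma T (\<lambda>t. {s \<in> sum_of_dilate A t. k \<le> r t s})"
  let ?Q = "\<lambda>(t, s). line_quads A m t s"
  have finD: "finite {s \<in> sum_of_dilate A t. k \<le> r t s}" for t
    using finite_sum_of_dilate[OF assms(1)] by simp
  have finI: "finite I" unfolding I_def using assms(4) finD by auto
  have finP: "finite (near_pairs A m)" using assms(1) by (rule finite_near_pairs)
  have "card T * ((card A)\<^sup>2 / 2) \<le> (\<Sum>t\<in>T. \<Sum>s | s \<in> sum_of_dilate A t \<and> k \<le> r t s. r t s)"
    using sum_mono[of T "\<lambda>_. (card A)\<^sup>2 / 2"] rich_lines_carry_half[OF assms(1) small]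
    by (simp add: r_def)
  also have "\<dots> = (\<Sum>(t, s)\<in>I. r t s)"
    unfolding I_def using assms(4) finD by (subst sum.Sigma) auto
  also have "\<dots> \<le> (\<Sum>i\<in>I. 3 * real (card (?Q i)))"
  proof (rule sum_mono, clarify)
    fix t s assume "(t, s) \<in> I"
    then have "t \<noteq> 0" "k \<le> r t s" using assms(5) by (auto simp: I_def)
    then have "r t s / 3 \<le> card (line_quads A m t s)"
      unfolding r_def m_def using assms(1,3) by (intro rich_line_many_quads)
    then show "r t s \<le> 3 * real (card (line_quads A m t s))" by simp
  qed
  also have "\<dots> = 3 * real (\<Sum>i\<in>I. card (?Q i))" by (simp add: sum_distrib_left)
  also have "(\<Sum>i\<in>I. card (?Q i)) = card (\<Union>i\<in>I. ?Q i)"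
  proof (intro card_UN_disjoint[symmetric] ballI impI)
    show "?Q i \<inter> ?Q j = {}" if "i \<noteq> j" for i j
      using that line_quads_disjoint by (cases i, cases j) blast
  qed (use finI finP in \<open>auto intro: finite_subset[OF line_quads_subset]\<close>)
  also have "card (\<Union>i\<in>I. ?Q i) \<le> card (near_pairs A m \<times> near_pairs A m)"
    using finP line_quads_subset by (intro card_mono) fastforce+
  also have "\<dots> = (card (near_pairs A m))\<^sup>2"
    by (simp add: card_cartesian_product power2_eq_square)
  finally have "card T * ((card A)\<^sup>2 / 2) \<le> 3 * (real (card (near_pairs A m)))\<^sup>2" by simp
  also have "\<dots> \<le> 3 * (card A * m)\<^sup>2"
    using card_near_pairs_le[of A m] assms(1,3)
    by (intro mult_left_mono power_mono) (auto simp: m_def)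
  finally have "(real (card A))\<^sup>2 * real (card T) \<le> (real (card A))\<^sup>2 * (6 * m\<^sup>2)"
    by (simp add: power_mult_distrib mult_ac)
  moreover have "0 < (real (card A))\<^sup>2" using assms(1,2) by (simp add: card_gt_0_iff)
  ultimately show ?thesis unfolding m_def by (simp only: mult_le_cancel_left_pos)
qed

section \<open>Choice of constants and finiteness\<close>

theorem theorem3:
  "\<exists>K1 K2 K3 :: real. K1 > 1 \<and> K2 > 1 \<and> K3 > 0 \<and>
     (\<forall>(A :: complex set) (N :: nat) (C :: real).
        finite A \<and> card A = N \<and> C \<ge> K1 \<and> sqrt (real N) \<ge> K2 * C \<longrightarrow>
          finite (T_set A C) \<and> real (card (T_set A C)) \<le> K3 * (real N / C\<^sup>2))"
proof -
  have "finite (T_set A C) \<and> real (card (T_set A C)) \<le> 17497 * (real N / C\<^sup>2)"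
    if A: "finite A" "card A = N" and C: "C \<ge> 2" and NC: "sqrt (real N) \<ge> 2 * C"
    for A :: "complex set" and N :: nat and C :: real
  proof -
    define q where "q = sqrt (real N)"
    \<comment> \<open>This is \<open>N^2 / (2 * M)\<close> for \<open>M = q^3 / C\<close>, the size
      bound without its logarithm.\<close>
    define k where "k = C * q / 2"
    have q4: "4 \<le> q" using C NC by (simp add: q_def)
    have N: "real N = q\<^sup>2" by (simp add: q_def)
    have "4\<^sup>2 \<le> q\<^sup>2" using q4 by (intro power_mono) auto
    then have N16: "16 \<le> real N" using N by simp
    have "2 * 4 \<le> C * q" using C q4 by (intro mult_mono) auto
    then have k: "2 \<le> k" by (simp add: k_def)
    have "exp 1 \<le> real N" using exp_le N16 by linarith
    then have "1 \<le> ln (real N)" using N16 by (subst ln_ge_iff) auto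
    then have log: "C * 1 \<le> C * sqrt (ln (real N))" using C by (intro mult_left_mono) auto
    have powr: "real N powr 1.5 = q ^ 3"
    proof -
      have "real N powr 1.5 = (q powr 2) powr 1.5" using N q4 by simp
      also have "\<dots> = q powr 3" by (simp add: powr_powr)
      finally show ?thesis using q4 by simp
    qed
    have small: "card (sum_of_dilate A t) * k \<le> (card A)\<^sup>2 / 2" if "t \<in> T_set A C" for t
    proof -
      have "card (sum_of_dilate A t) \<le> q ^ 3 / (C * sqrt (ln (real N)))"
        using that A(2) powr by (simp add: T_set_def)
      also have "\<dots> \<le> q ^ 3 / C" using log C q4 by (intro divide_left_mono) auto
      finally have "card (sum_of_dilate A t) * k \<le> q ^ 3 / C * k"
        using k by (intro mult_right_mono) auto
      also have "\<dots> = (card A)\<^sup>2 / 2"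
        using C A(2) by (simp add: k_def N power2_eq_square power3_eq_cube)
      finally show ?thesis .
    qed
    \<comment> \<open>Here \<open>17496 = 6 * 54^2\<close>. The final constant is one larger to
      admit \<open>t = 0\<close>, using \<open>1 \<le> N / C^2\<close>.\<close>
    have m: "6 * (27 * card A / k)\<^sup>2 = 17496 * (real N / C\<^sup>2)"
      using C q4 A(2) by (simp add: k_def N field_simps power2_eq_square)
    have "C\<^sup>2 \<le> q\<^sup>2" using C NC by (intro power_mono) (auto simp: q_def)
    then have one: "1 \<le> real N / C\<^sup>2" using C N by simp
    define b where "b = nat \<lfloor>17496 * (real N / C\<^sup>2)\<rfloor>"
    have "A \<noteq> {}" using A(2) N16 by auto
    \<comment> \<open>Since \<open>card\<close> is 0 on infinite sets, finiteness needs its own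
      argument: a uniform bound on all finite subsets gives it together with the count.\<close>
    have "card T \<le> b" if "T \<subseteq> T_set A C - {0}" "finite T" for T
    proof -
      have "real (card T) \<le> 6 * (27 * card A / k)\<^sup>2"
        using that small by (intro card_dilates_le[OF A(1) \<open>A \<noteq> {}\<close> k]) auto
      then show ?thesis unfolding m b_def by (simp add: le_nat_floor)
    qed
    then have b: "finite (T_set A C - {0}) \<and> card (T_set A C - {0}) \<le> b"
      by (intro finite_if_finite_subsets_card_bdd) auto
    then have fin: "finite (T_set A C)" by simp
    have "card (T_set A C) - card {0 :: complex} \<le> card (T_set A C - {0})"
      by (intro diff_card_le_card_Diff) simp
    also have "\<dots> \<le> b" using b by blast
    finally have "card (T_set A C) \<le> Suc b" by simp
    moreover have "real b \<le> 17496 * (real N / C\<^sup>2)"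
      unfolding b_def using one by (intro of_nat_floor) simp
    ultimately have "real (card (T_set A C)) \<le> 17497 * (real N / C\<^sup>2)" using one by linarith
    with fin show ?thesis by blast
  qed
  then show ?thesis
    by (intro exI[of _ 2] exI[of _ 17497]) auto
qed

end
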